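(* Let $q\in\mathbb{C}^{N^2}$. The radical of the symmetric bilinear form $S_q$ on $\mathcal{B}_q$ is the ideal $\mathcal{I}_q$. Consequently, via the projection $\pi:\mathcal{B}_q\to\mathcal{B}'_q=\mathcal{B}_q/\mathcal{I}_q$, $S_q$ induces a nondegenerate bilinear form on $\mathcal{B}'_q$.
   Context: Let $\mathcal{B}=\bigoplus_{n\ge0}\mathcal{B}(n)$ be the unital associative $\mathbb{C}$-algebra freely generated by $\xi_1,\dots,\xi_N$, graded by degree. Given $q=(q_{ij})\in\mathbb{C}^{N^2}$, $\mathcal{B}_q$ is $\mathcal{B}$ equipped with the linear operators $\partial_i$ determined by $\partial_i1=0$, $\partial_i(\xi_jx)=\delta_{ij}x+q_{ij}\xi_j\partial_ix$. Let $J_q:\mathcal{B}_q\to\mathrm{End}\,\mathcal{B}$ be the unital algebra homomorphism with $J_q(\xi_i)=\partial_i$. The form $S_q$ on $\mathcal{B}_q$ is $S_q(x,y)=\big((J_qx)y\big)_0$, where $(\cdot)_0$ is the projection $\mathcal{B}_q\to\mathcal{B}(0)=\mathbb{C}$ on the degree-$0$ component. A constant is a nonzero $C\in\bigoplus_{n\ge1}\mathcal{B}(n)$ with $\partial_iC=0$ for all $i$; $\mathcal{I}_q$ is the two-sided ideal of $\mathcal{B}_q$ generated by the constants. *)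

theory Defs
  imports Complex_Main "HOL-Library.Poly_Mapping" "HOL-Algebra.QuotRing" "HOL-Algebra.Module"
begin

section \<open>The free associative algebra\<close>

text \<open>
  Words over \<open>'n\<close> form the free monoid. Since the convolution product of
  \<^theory>\<open>HOL-Library.Poly_Mapping\<close> expects the monoid to be written additively,
  \<open>+\<close> on lists is concatenation. Finitely supported complex functions
  on words, with this product, are then the free unital associative algebra on
  generators indexed by \<open>'n\<close>, and \<open>single w c\<close> is the monomial \<open>c w\<close>.
\<close>

instantiation list :: (type) monoid_add
begin
definition zero_list :: "'a list" where "zero_list = []"
definition plus_list :: "'a list \<Rightarrow> 'a list \<Rightarrow> 'a list" where "plus_list = (@)"
instance by standard (simp_all add: zero_list_def plus_list_def)
end

type_synonym 'n free_alg = "'n list \<Rightarrow>\<^sub>0 complex"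

definition fa_scale :: "complex \<Rightarrow> 'n free_alg \<Rightarrow> 'n free_alg"
  where "fa_scale c x = Poly_Mapping.map ((*) c) x"

definition monom :: "'n list \<Rightarrow> 'n free_alg"
  where "monom w = Poly_Mapping.single w 1"

definition gen :: "'n \<Rightarrow> 'n free_alg"
  where "gen i = monom [i]"

definition free_algebra :: "(complex, 'n free_alg) module"
  where "free_algebra = \<lparr>carrier = UNIV, mult = (*), one = 1, zero = 0, add = (+), smult = fa_scale\<rparr>"

text \<open>The direct sum of the homogeneous components of degree \<open>n \<ge> 1\<close>.\<close>

definition fa_positive :: "'n free_alg set"
  where "fa_positive = {x. \<forall>w\<in>Poly_Mapping.keys x. length w \<ge> 1}"

definition fa_degree0 :: "'n free_alg \<Rightarrow> complex"
  where "fa_degree0 x = Poly_Mapping.lookup x []"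

text \<open>Linear extension of a map given on the basis of words.\<close>

definition fa_extend :: "('n list \<Rightarrow> 'm free_alg) \<Rightarrow> 'n free_alg \<Rightarrow> 'm free_alg"
  where "fa_extend f x = (\<Sum>w\<in>Poly_Mapping.keys x. fa_scale (Poly_Mapping.lookup x w) (f w))"


section \<open>The operators, the homomorphism \<open>J\<close> and the form\<close>

primrec partial_word :: "('n \<Rightarrow> 'n \<Rightarrow> complex) \<Rightarrow> 'n \<Rightarrow> 'n list \<Rightarrow> 'n free_alg" where
  "partial_word q i [] = 0"
| "partial_word q i (j # w) =
     (if i = j then monom w else 0) + fa_scale (q i j) (gen j * partial_word q i w)"

definition partial :: "('n \<Rightarrow> 'n \<Rightarrow> complex) \<Rightarrow> 'n \<Rightarrow> 'n free_alg \<Rightarrow> 'n free_alg"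
  where "partial q i = fa_extend (partial_word q i)"

text \<open>
  The word \<open>i\<^sub>1 \<dots> i\<^sub>k\<close> acts as \<open>partial q i\<^sub>1 \<circ> \<dots> \<circ> partial q i\<^sub>k\<close>, and \<open>J\<close> is the linear extension
  of this assignment; see \<open>J_hom_one\<close>, \<open>J_hom_mult\<close>, \<open>J_hom_gen\<close> and \<open>J_hom_unique\<close> below.
\<close>

definition J_word :: "('n \<Rightarrow> 'n \<Rightarrow> complex) \<Rightarrow> 'n list \<Rightarrow> 'n free_alg \<Rightarrow> 'n free_alg"
  where "J_word q w = foldr (\<lambda>i g. partial q i \<circ> g) w id"

definition J_hom :: "('n \<Rightarrow> 'n \<Rightarrow> complex) \<Rightarrow> 'n free_alg \<Rightarrow> 'n free_alg \<Rightarrow> 'n free_alg"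
  where "J_hom q x = (\<lambda>y. fa_extend (\<lambda>w. J_word q w y) x)"

definition S_form :: "('n \<Rightarrow> 'n \<Rightarrow> complex) \<Rightarrow> 'n free_alg \<Rightarrow> 'n free_alg \<Rightarrow> complex"
  where "S_form q x y = fa_degree0 (J_hom q x y)"


section \<open>Constants, their ideal and quotients\<close>

definition constants :: "('n \<Rightarrow> 'n \<Rightarrow> complex) \<Rightarrow> 'n free_alg set"
  where "constants q = {C. C \<in> fa_positive \<and> C \<noteq> 0 \<and> (\<forall>i. partial q i C = 0)}"

text \<open>\<^const>\<open>ideal\<close> and \<^const>\<open>genideal\<close> of the library are two-sided.\<close>

definition constants_ideal :: "('n \<Rightarrow> 'n \<Rightarrow> complex) \<Rightarrow> 'n free_alg set"
  where "constants_ideal q = genideal free_algebra (constants q)"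

text \<open>The library's quotient ring, equipped with the induced scalar multiplication.\<close>

definition quotient_algebra :: "('k, 'a) module \<Rightarrow> 'a set \<Rightarrow> ('k, 'a set) module"
  where "quotient_algebra M I =
    ring.extend (M Quot I) (module.fields (\<lambda>c X. \<Union>x\<in>X. I +>\<^bsub>M\<^esub> (c \<odot>\<^bsub>M\<^esub> x)))"


section \<open>Bilinear forms\<close>

definition bilinear_form :: "(complex, 'a) module \<Rightarrow> ('a \<Rightarrow> 'a \<Rightarrow> complex) \<Rightarrow> bool"
  where "bilinear_form M f \<longleftrightarrow>
    (\<forall>x\<in>carrier M. \<forall>y\<in>carrier M. \<forall>z\<in>carrier M.
       f (x \<oplus>\<^bsub>M\<^esub> y) z = f x z + f y z \<and> f z (x \<oplus>\<^bsub>M\<^esub> y) = f z x + f z y) \<and>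
    (\<forall>c. \<forall>x\<in>carrier M. \<forall>y\<in>carrier M.
       f (c \<odot>\<^bsub>M\<^esub> x) y = c * f x y \<and> f x (c \<odot>\<^bsub>M\<^esub> y) = c * f x y)"

definition symmetric_form :: "(complex, 'a) module \<Rightarrow> ('a \<Rightarrow> 'a \<Rightarrow> complex) \<Rightarrow> bool"
  where "symmetric_form M f \<longleftrightarrow> (\<forall>x\<in>carrier M. \<forall>y\<in>carrier M. f x y = f y x)"

text \<open>This is the left radical; it is only used for symmetric forms.\<close>

definition radical :: "(complex, 'a) module \<Rightarrow> ('a \<Rightarrow> 'a \<Rightarrow> complex) \<Rightarrow> 'a set"
  where "radical M f = {x \<in> carrier M. \<forall>y\<in>carrier M. f x y = 0}"

definition nondegenerate_form :: "(complex, 'a) module \<Rightarrow> ('a \<Rightarrow> 'a \<Rightarrow> complex) \<Rightarrow> bool"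
  where "nondegenerate_form M f \<longleftrightarrow>
    (\<forall>x\<in>carrier M. (\<forall>y\<in>carrier M. f x y = 0) \<longrightarrow> x = \<zero>\<^bsub>M\<^esub>) \<and>
    (\<forall>y\<in>carrier M. (\<forall>x\<in>carrier M. f x y = 0) \<longrightarrow> y = \<zero>\<^bsub>M\<^esub>)"


section \<open>The definitions satisfy the characterizing equations\<close>

lemma fa_scale_eq: "fa_scale c x = Poly_Mapping.single [] c * x"
  by (simp add: fa_scale_def mult_map_scale_conv_mult zero_list_def)

lemma lookup_fa_scale [simp]: "Poly_Mapping.lookup (fa_scale c x) w = c * Poly_Mapping.lookup x w"
  by (simp add: fa_scale_def Poly_Mapping.map.rep_eq when_def)

lemma fa_scale_simps [simp]:
  "fa_scale c 0 = 0" "fa_scale 0 x = 0" "fa_scale 1 x = x"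
  "fa_scale c (fa_scale d x) = fa_scale (c * d) x"
  by (auto intro!: poly_mapping_eqI)

lemma fa_scale_add: "fa_scale c (x + y) = fa_scale c x + fa_scale c y"
  "fa_scale (c + d) x = fa_scale c x + fa_scale d x"
  by (auto intro!: poly_mapping_eqI simp: lookup_add algebra_simps)

lemma fa_scale_sum: "fa_scale c (sum f A) = (\<Sum>a\<in>A. fa_scale c (f a))"
  by (induction A rule: infinite_finite_induct) (simp_all add: fa_scale_add)

lemma monom_append: "monom (v @ w) = monom v * monom w"
  by (simp add: monom_def mult_single plus_list_def)

lemma monom_Nil: "monom [] = 1"
  by (metis monom_def single_one zero_list_def)

lemma monom_Cons: "monom (j # w) = gen j * monom w"
  using monom_append[of "[j]" w] by (simp add: gen_def)

lemma single_mult_commute: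
  "x * Poly_Mapping.single [] c = Poly_Mapping.single [] c * (x :: 'n free_alg)"
proof (induction x rule: update_induct)
  case const
  then show ?case by simp
next
  case (update f a b)
  have "Poly_Mapping.update a b f = f + Poly_Mapping.single a b"
    using update
    by (auto intro!: poly_mapping_eqI simp: lookup_update lookup_add lookup_single when_def
        dest: not_in_keys_iff_lookup_eq_zero[THEN iffD1])
  then show ?case
    using update by (simp add: algebra_simps mult_single plus_list_def)
qed

lemma fa_scale_mult:
  "fa_scale c (x * y) = fa_scale c x * y" "fa_scale c (x * y) = x * fa_scale c y"
  by (simp_all add: fa_scale_eq mult.assoc flip: single_mult_commute)

lemma fa_extend_superset:
  assumes "finite A" "Poly_Mapping.keys x \<subseteq> A"
  shows "fa_extend f x = (\<Sum>w\<in>A. fa_scale (Poly_Mapping.lookup x w) (f w))"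
  unfolding fa_extend_def
  using assms by (intro sum.mono_neutral_left) (auto simp: in_keys_iff)

lemma fa_extend_add: "fa_extend f (x + y) = fa_extend f x + fa_extend f y"
proof -
  let ?A = "Poly_Mapping.keys x \<union> Poly_Mapping.keys y"
  have "Poly_Mapping.keys (x + y) \<subseteq> ?A" by (rule Poly_Mapping.keys_add)
  then show ?thesis
    by (simp add: fa_extend_superset[where A = ?A] lookup_add fa_scale_add sum.distrib)
qed

lemma fa_extend_scale: "fa_extend f (fa_scale c x) = fa_scale c (fa_extend f x)"
proof -
  have "Poly_Mapping.keys (fa_scale c x) \<subseteq> Poly_Mapping.keys x"
    by (auto simp: in_keys_iff)
  then show ?thesis
    by (simp add: fa_extend_superset[where A = "Poly_Mapping.keys x"] fa_scale_sum)
qed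

lemma fa_extend_monom [simp]: "fa_extend f (monom w) = f w"
  by (simp add: fa_extend_def monom_def)

lemma fa_extend_zero [simp]: "fa_extend f 0 = 0"
  by (simp add: fa_extend_def)

lemma free_alg_induct [case_names zero add]:
  assumes "P 0" and "\<And>c w x. P x \<Longrightarrow> P (x + fa_scale c (monom w))"
  shows "P (x :: 'n free_alg)"
proof (induction x rule: update_induct)
  case const
  then show ?case using assms(1) by simp
next
  case (update f a b)
  have "Poly_Mapping.update a b f = f + fa_scale b (monom a)"
    using update
    by (auto intro!: poly_mapping_eqI simp: lookup_update lookup_add monom_def lookup_single when_def
        dest: not_in_keys_iff_lookup_eq_zero[THEN iffD1])
  then show ?case using assms(2)[of f b a] update by simp
qed

lemma partial_add: "partial q i (x + y) = partial q i x + partial q i y"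
  and partial_scale: "partial q i (fa_scale c x) = fa_scale c (partial q i x)"
  by (simp_all add: partial_def fa_extend_add fa_extend_scale)

lemma partial_one: "partial q i 1 = 0"
  by (simp add: partial_def flip: monom_Nil)

lemma partial_gen_mult:
  "partial q i (gen j * x) = (if i = j then x else 0) + fa_scale (q i j) (gen j * partial q i x)"
proof (induction x rule: free_alg_induct)
  case zero
  then show ?case by (simp add: partial_def)
next
  case (add c w x)
  have "partial q i (gen j * monom w) =
      (if i = j then monom w else 0) + fa_scale (q i j) (gen j * partial q i (monom w))"
    by (simp add: partial_def flip: monom_Cons)
  then show ?case
    using add
    by (simp add: distrib_left partial_add partial_scale fa_scale_add mult.commute
        flip: fa_scale_mult(2))
qed

lemma partial_unique:
  assumes "\<And>x y. D (x + y) = D x + D y" and "\<And>c x. D (fa_scale c x) = fa_scale c (D x)"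
    and "D 1 = 0"
    and "\<And>j x. D (gen j * x) = (if i = j then x else 0) + fa_scale (q i j) (gen j * D x)"
  shows "D = partial q i"
proof
  fix x
  have mon: "D (monom w) = partial q i (monom w)" for w
    by (induction w)
       (simp_all add: monom_Nil monom_Cons assms(3,4) partial_one partial_gen_mult)
  have "D 0 = 0" using assms(2)[of 0 0] by simp
  then show "D x = partial q i x"
    by (induction x rule: free_alg_induct)
       (simp_all add: assms(1,2) mon partial_add partial_scale, simp add: partial_def)
qed

lemma J_word_simps [simp]:
  "J_word q [] = id" "J_word q (i # w) = partial q i \<circ> J_word q w"
  by (simp_all add: J_word_def)

lemma J_word_add: "J_word q w (x + y) = J_word q w x + J_word q w y"
  and J_word_scale: "J_word q w (fa_scale c x) = fa_scale c (J_word q w x)"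
  by (induction w) (simp_all add: partial_add partial_scale)

lemma J_word_zero: "J_word q w 0 = 0"
  using J_word_scale[of q w 0 0] by simp

lemma J_word_append: "J_word q (v @ w) = J_word q v \<circ> J_word q w"
  by (induction v) (simp_all add: comp_assoc)

lemma J_hom_add: "J_hom q (x + y) z = J_hom q x z + J_hom q y z"
  and J_hom_scale: "J_hom q (fa_scale c x) z = fa_scale c (J_hom q x z)"
  by (simp_all add: J_hom_def fa_extend_add fa_extend_scale)

lemma J_hom_add_right: "J_hom q x (y + z) = J_hom q x y + J_hom q x z"
  and J_hom_scale_right: "J_hom q x (fa_scale c y) = fa_scale c (J_hom q x y)"
  by (simp_all add: J_hom_def fa_extend_def J_word_add J_word_scale fa_scale_add sum.distrib
      fa_scale_sum mult.commute)

lemma J_hom_monom: "J_hom q (monom w) = J_word q w"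
  by (simp add: J_hom_def fun_eq_iff)

lemma J_hom_zero: "J_hom q 0 = (\<lambda>y. 0)"
  by (simp add: J_hom_def)

lemma J_hom_one: "J_hom q 1 = id"
  by (simp add: J_hom_monom flip: monom_Nil)

lemma J_hom_gen: "J_hom q (gen i) = partial q i"
  by (simp add: J_hom_monom gen_def)

lemma J_hom_zero_right: "J_hom q x 0 = 0"
  using J_hom_scale_right[of q x 0 0] by simp

lemma J_hom_mult: "J_hom q (x * y) = J_hom q x \<circ> J_hom q y"
proof
  fix z
  have mon: "J_hom q (monom v * y) z = J_hom q (monom v) (J_hom q y z)" for v
    by (induction y rule: free_alg_induct)
       (simp_all add: J_hom_zero J_hom_zero_right distrib_left J_hom_add J_hom_scale J_hom_add_right
         J_hom_scale_right J_hom_monom J_word_append J_word_add J_word_scale J_word_zero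
         flip: fa_scale_mult(2) monom_append)
  show "J_hom q (x * y) z = (J_hom q x \<circ> J_hom q y) z"
    by (induction x rule: free_alg_induct)
       (simp_all add: J_hom_zero distrib_right J_hom_add J_hom_scale mon flip: fa_scale_mult(1))
qed

lemma J_hom_unique:
  assumes "\<And>x y z. J (x + y) z = J x z + J y z" "\<And>c x z. J (fa_scale c x) z = fa_scale c (J x z)"
    and "J 1 = id" "\<And>x y. J (x * y) = J x \<circ> J y" "\<And>i. J (gen i) = partial q i"
  shows "J = J_hom q"
proof (intro ext)
  fix x z
  have mon: "J (monom w) = J_hom q (monom w)" for w
    by (induction w)
       (simp_all add: monom_Nil monom_Cons assms(3-5) J_hom_one J_hom_mult J_hom_gen)
  have "J 0 z = 0" using assms(2)[of 0 0 z] by simp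
  then show "J x z = J_hom q x z"
    by (induction x rule: free_alg_induct)
       (simp_all add: assms(1,2) mon J_hom_zero J_hom_add J_hom_scale)
qed

lemma free_algebra_simps [simp]:
  "carrier free_algebra = UNIV" "mult free_algebra = (*)" "one free_algebra = 1"
  "zero free_algebra = 0" "add free_algebra = (+)" "smult free_algebra = fa_scale"
  by (simp_all add: free_algebra_def)

lemma free_algebra_ring: "ring (free_algebra :: (complex, 'n free_alg) module)"
proof (rule ringI)
  show "abelian_group (free_algebra :: (complex, 'n free_alg) module)"
  proof (rule abelian_groupI)
    fix x :: "'n free_alg"
    show "\<exists>y\<in>carrier free_algebra. y \<oplus>\<^bsub>free_algebra\<^esub> x = \<zero>\<^bsub>free_algebra\<^esub>"
      by (auto intro!: exI[of _ "- x"])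
  qed (simp_all add: algebra_simps)
  show "Group.monoid (free_algebra :: (complex, 'n free_alg) module)"
    by unfold_locales (simp_all add: algebra_simps)
qed (simp_all add: algebra_simps)

lemma constants_ideal_ideal: "ideal (constants_ideal q) free_algebra"
  unfolding constants_ideal_def by (rule ring.genideal_ideal[OF free_algebra_ring]) simp

lemma quotient_algebra_simps [simp]:
  "carrier (quotient_algebra M I) = a_rcosets\<^bsub>M\<^esub> I" "mult (quotient_algebra M I) = rcoset_mult M I"
  "one (quotient_algebra M I) = I +>\<^bsub>M\<^esub> \<one>\<^bsub>M\<^esub>" "zero (quotient_algebra M I) = I"
  "add (quotient_algebra M I) = set_add M"
  "smult (quotient_algebra M I) = (\<lambda>c X. \<Union>x\<in>X. I +>\<^bsub>M\<^esub> (c \<odot>\<^bsub>M\<^esub> x))"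
  by (simp_all add: quotient_algebra_def FactRing_def ring.extend_def module.fields_def)

lemma quotient_algebra_smult:
  assumes "ideal I free_algebra"
  shows "c \<odot>\<^bsub>quotient_algebra free_algebra I\<^esub> (I +>\<^bsub>free_algebra\<^esub> x) = I +>\<^bsub>free_algebra\<^esub> fa_scale c x"
proof -
  interpret ideal I free_algebra by fact
  have mem: "fa_scale c h \<in> I" if "h \<in> I" for h
    using I_l_closed[OF that, of "Poly_Mapping.single [] c"] by (simp add: fa_scale_eq)
  have eq: "I +>\<^bsub>free_algebra\<^esub> fa_scale c y = I +>\<^bsub>free_algebra\<^esub> fa_scale c x"
    if "y \<in> I +>\<^bsub>free_algebra\<^esub> x" for y
  proof -
    obtain h where h: "h \<in> I" "y = h + x"
      using \<open>y \<in> I +>\<^bsub>free_algebra\<^esub> x\<close> by (auto simp: a_r_coset_def r_coset_def)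
    then have "fa_scale c y \<in> I +>\<^bsub>free_algebra\<^esub> fa_scale c x"
      using mem[of h] by (auto simp: a_r_coset_def r_coset_def fa_scale_add)
    then show ?thesis
      by (rule a_repr_independence'[symmetric]) simp
  qed
  have "x \<in> I +>\<^bsub>free_algebra\<^esub> x"
    by (rule a_rcos_self) simp
  then have "(\<Union>y\<in>I +>\<^bsub>free_algebra\<^esub> x. I +>\<^bsub>free_algebra\<^esub> fa_scale c y) = I +>\<^bsub>free_algebra\<^esub> fa_scale c x"
    by (intro SUP_eq_const eq) blast+
  then show ?thesis by simp
qed


end

theory Submission
  imports Defs
begin

text \<open>
  Write \<open>\<partial>\<^sub>i\<close> for \<open>partial q i\<close>, \<open>J\<close> for \<open>J_hom q\<close> and \<open>S\<close> for \<open>S_form q\<close>, and call \<open>c\<close> closed if all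
  \<open>\<partial>\<^sub>i c\<close> vanish.

  As \<open>J\<close> is multiplicative, right multiplication by \<open>y\<close> is adjoint to \<open>J(y)\<close>: \<open>S(xy, z) = S(x, J(y) z)\<close>.
  The symmetry of \<open>S\<close> comes from the mirror image of this on generators, \<open>S(u, x \<xi>\<^sub>i) = S(\<partial>\<^sub>i u, x)\<close>, which is the degree-0 part of the
  operator identity \<open>J(u)(x \<xi>\<^sub>i) = J(u)(x) \<xi>\<^sub>i + \<sigma>\<^sub>i(J(\<partial>\<^sub>i u) x)\<close>. Here \<open>\<sigma>\<^sub>i\<close> is the algebra
  endomorphism \<open>\<xi>\<^sub>j \<mapsto> q\<^sub>i\<^sub>j \<xi>\<^sub>j\<close> (\<open>J_hom_mult_gen\<close>, \<open>S_form_sym\<close>). The same identity shows that \<open>J(x) = 0\<close> as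
  soon as \<open>x\<close> is in the radical. So the radical is the kernel of the algebra homomorphism \<open>J\<close>, in particular
  a two-sided ideal, and it contains the constants \<open>C\<close>
  because \<open>S(y \<xi>\<^sub>i, C) = S(y, \<partial>\<^sub>i C)\<close> and \<open>S(1, C)\<close> is the degree-0 part of \<open>C\<close>.

  Conversely, let \<open>x\<close> be in the radical, and let \<open>m\<close> be such that all words longer than \<open>m\<close> annihilate \<open>x\<close>
  through \<open>J\<close>. For \<open>w\<close> of length \<open>m\<close> the element \<open>J(w) x\<close> is then closed. It is again in the radical, so
  it has no degree-0 part: it is a constant or 0. Now \<open>S\<close> is nondegenerate on the degree-\<open>m\<close> component modulo
  the radical, which gives finitely many \<open>b\<^sub>k\<close>, \<open>y\<^sub>k\<close> of degree \<open>m\<close> with \<open>w = \<Sum>\<^sub>k S(w, y\<^sub>k) b\<^sub>k\<close> modulo the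
  radical for all words \<open>w\<close> of length \<open>m\<close> (\<open>dual_system\<close>). Put \<open>z = \<Sum>\<^sub>k y\<^sub>k (J(b\<^sub>k) x)\<close>, an element of the
  ideal of constants. By the skew Leibniz rule \<open>\<partial>\<^sub>i(yc) = (\<partial>\<^sub>i y) c\<close> for closed \<open>c\<close>, with no factor from \<open>q\<close>;
  hence \<open>J(w) z = \<Sum>\<^sub>k S(w, y\<^sub>k) J(b\<^sub>k) x = J(w) x\<close>, and \<open>x - z\<close> is annihilated by the words of length \<open>m\<close>
  too. Descending in \<open>m\<close> removes all of \<open>x\<close>. The absence of a factor matters because entries of \<open>q\<close> may
  be 0: the analogous argument with \<open>c\<close> on the left would have to divide by products of entries.
\<close>

section \<open>Linear maps on the free algebra\<close>

definition fa_linear :: "('n free_alg \<Rightarrow> 'm free_alg) \<Rightarrow> bool"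
  where "fa_linear f \<longleftrightarrow> (\<forall>x y. f (x + y) = f x + f y) \<and> (\<forall>c x. f (fa_scale c x) = fa_scale c (f x))"

lemma fa_linear_add: "fa_linear f \<Longrightarrow> f (x + y) = f x + f y"
  and fa_linear_scale: "fa_linear f \<Longrightarrow> f (fa_scale c x) = fa_scale c (f x)"
  by (simp_all add: fa_linear_def)

lemma fa_linear_zero: "fa_linear f \<Longrightarrow> f 0 = 0"
  using fa_linear_scale[of f 0 0] by simp

lemma fa_linear_diff: "fa_linear f \<Longrightarrow> f (x - y) = f x - f y"
  using fa_linear_add[of f "x - y" y] by simp

lemma fa_linear_sum: "fa_linear f \<Longrightarrow> f (\<Sum>a\<in>A. g a) = (\<Sum>a\<in>A. f (g a))"
  by (induction A rule: infinite_finite_induct) (simp_all add: fa_linear_zero fa_linear_add)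

lemma fa_linear_eqI:
  assumes "fa_linear f" "fa_linear g" "\<And>w. f (monom w) = g (monom w)"
  shows "f x = g x"
  by (induction x rule: free_alg_induct)
     (simp_all add: assms fa_linear_zero fa_linear_add fa_linear_scale)

lemma fa_linear_id: "fa_linear (\<lambda>x. x)"
  and fa_linear_mult_left: "fa_linear f \<Longrightarrow> fa_linear (\<lambda>x. c * f x)"
  and fa_linear_mult_right: "fa_linear f \<Longrightarrow> fa_linear (\<lambda>x. f x * c)"
  and fa_linear_plus: "fa_linear f \<Longrightarrow> fa_linear g \<Longrightarrow> fa_linear (\<lambda>x. f x + g x)"
  and fa_linear_scaled: "fa_linear f \<Longrightarrow> fa_linear (\<lambda>x. fa_scale a (f x))"
  and fa_linear_compose: "fa_linear h \<Longrightarrow> fa_linear f \<Longrightarrow> fa_linear (\<lambda>x. h (f x))"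
  and fa_linear_extend: "fa_linear (fa_extend e)"
  by (simp_all add: fa_linear_def fa_extend_add fa_extend_scale distrib_left distrib_right
      fa_scale_add algebra_simps fa_scale_mult(1)[symmetric] fa_scale_mult(2)[symmetric])

lemma fa_linear_partial: "fa_linear (partial q i)"
  by (simp add: fa_linear_def partial_add partial_scale)

lemma fa_linear_J_left: "fa_linear (\<lambda>x. J_hom q x y)"
  by (simp add: fa_linear_def J_hom_add J_hom_scale)

lemma fa_linear_J_right: "fa_linear (J_hom q x)"
  by (simp add: fa_linear_def J_hom_add_right J_hom_scale_right)

section \<open>The skew Leibniz rule\<close>

text \<open>The algebra endomorphism \<open>\<xi>\<^sub>j \<mapsto> q\<^sub>i\<^sub>j \<xi>\<^sub>j\<close>, which \<open>\<partial>\<^sub>i\<close> picks up when it moves past an element.\<close>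

definition twist :: "('n \<Rightarrow> 'n \<Rightarrow> complex) \<Rightarrow> 'n \<Rightarrow> 'n free_alg \<Rightarrow> 'n free_alg"
  where "twist q i = fa_extend (\<lambda>w. fa_scale (\<Prod>j\<leftarrow>w. q i j) (monom w))"

lemma fa_linear_twist: "fa_linear (twist q i)"
  unfolding twist_def by (rule fa_linear_extend)

lemmas fa_linear_intros = fa_linear_id fa_linear_mult_left fa_linear_mult_right fa_linear_plus
  fa_linear_scaled fa_linear_partial fa_linear_twist fa_linear_J_left fa_linear_J_right
  fa_linear_compose[OF fa_linear_partial] fa_linear_compose[OF fa_linear_twist]
  fa_linear_compose[OF fa_linear_J_left]

lemma twist_one: "twist q i 1 = 1"
  by (simp add: twist_def flip: monom_Nil)

lemma twist_gen_mult: "twist q i (gen j * x) = fa_scale (q i j) (gen j * twist q i x)"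
proof (rule fa_linear_eqI[of "\<lambda>x. twist q i (gen j * x)"])
  fix w
  show "twist q i (gen j * monom w) = fa_scale (q i j) (gen j * twist q i (monom w))"
    by (simp add: twist_def flip: monom_Cons fa_scale_mult(2))
qed (intro fa_linear_intros)+

text \<open>
  The recursion for \<open>\<partial>\<^sub>i\<close> iterated along the left factor. The uses are \<open>y = \<xi>\<^sub>k\<close>, and \<open>y\<close> annihilated by all
  \<open>\<partial>\<^sub>i\<close>, where the twisted term disappears.
\<close>

lemma partial_mult: "partial q i (x * y) = partial q i x * y + twist q i x * partial q i y"
proof (rule fa_linear_eqI[of "\<lambda>x. partial q i (x * y)"])
  fix w
  show "partial q i (monom w * y) = partial q i (monom w) * y + twist q i (monom w) * partial q i y"
    by (induction w)
       (simp_all add: monom_Nil monom_Cons partial_one twist_one partial_gen_mult twist_gen_mult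
         mult.assoc distrib_left distrib_right fa_scale_add fa_scale_mult(1)[symmetric])
qed (intro fa_linear_intros)+

lemma partial_gen: "partial q k (gen i) = (if k = i then 1 else 0)"
  using partial_gen_mult[of q k i 1] by (simp add: partial_one)

lemma partial_twist: "partial q k (twist q i x) = fa_scale (q i k) (twist q i (partial q k x))"
proof (rule fa_linear_eqI[of "\<lambda>x. partial q k (twist q i x)"])
  fix w
  show "partial q k (twist q i (monom w)) = fa_scale (q i k) (twist q i (partial q k (monom w)))"
    by (induction w)
       (simp_all add: monom_Nil monom_Cons partial_one twist_one partial_gen_mult twist_gen_mult
         partial_scale fa_linear_zero[OF fa_linear_twist] fa_linear_add[OF fa_linear_twist]
         fa_linear_scale[OF fa_linear_twist] fa_scale_add fa_scale_mult(2)[symmetric] mult_ac)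
qed (intro fa_linear_intros)+

text \<open>
  Applying the derivations of a word \<open>u\<close> to \<open>x \<xi>\<^sub>i\<close>, either none of them hits the last letter, or one of the
  letters \<open>i\<close> of \<open>u\<close> does. That letter is then deleted from \<open>u\<close> and leaves a twist, and moving the twist to the
  front costs \<open>q\<^sub>i\<^sub>k\<close> for each letter \<open>k\<close> standing before it (\<open>partial_twist\<close>). These are exactly the
  coefficients of \<open>\<partial>\<^sub>i u\<close>.
\<close>

lemma J_hom_mult_gen:
  "J_hom q u (x * gen i) = J_hom q u x * gen i + twist q i (J_hom q (partial q i u) x)"
proof (rule fa_linear_eqI[of "\<lambda>u. J_hom q u (x * gen i)"])
  fix w
  show "J_hom q (monom w) (x * gen i) =
      J_hom q (monom w) x * gen i + twist q i (J_hom q (partial q i (monom w)) x)"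
  proof (induction w)
    case Nil
    then show ?case
      by (simp add: monom_Nil J_hom_one partial_one J_hom_zero fa_linear_zero[OF fa_linear_twist])
  next
    case (Cons k w)
    have "J_hom q (monom (k # w)) (x * gen i) = partial q k (J_hom q (monom w) (x * gen i))"
      by (simp add: J_hom_monom)
    also have "\<dots> = J_hom q (monom (k # w)) x * gen i + (if i = k then twist q i (J_hom q (monom w) x) else 0)
       + fa_scale (q i k) (twist q i (partial q k (J_hom q (partial q i (monom w)) x)))"
      unfolding Cons.IH by (simp add: partial_add partial_mult partial_gen partial_twist J_hom_monom)
    also have "\<dots> = J_hom q (monom (k # w)) x * gen i + twist q i (J_hom q (partial q i (monom (k # w))) x)"
      by (simp add: monom_Cons partial_gen_mult J_hom_add J_hom_scale J_hom_mult J_hom_gen J_hom_zero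
          fa_linear_zero[OF fa_linear_twist] fa_linear_add[OF fa_linear_twist]
          fa_linear_scale[OF fa_linear_twist])
    finally show ?case .
  qed
qed (intro fa_linear_intros)+

section \<open>The form\<close>

lemma fa_degree0_simps [simp]:
  "fa_degree0 0 = 0" "fa_degree0 (x + y) = fa_degree0 x + fa_degree0 y"
  "fa_degree0 (x - y) = fa_degree0 x - fa_degree0 y" "fa_degree0 (fa_scale c x) = c * fa_degree0 x"
  by (simp_all add: fa_degree0_def lookup_add lookup_minus)

lemma fa_degree0_monom: "fa_degree0 (monom w) = (if w = [] then 1 else 0)"
  by (simp add: fa_degree0_def monom_def lookup_single when_def)

lemma fa_degree0_one [simp]: "fa_degree0 1 = 1"
  by (simp add: fa_degree0_monom flip: monom_Nil)

lemma fa_degree0_mult_gen: "fa_degree0 (x * gen i) = 0"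
  by (induction x rule: free_alg_induct)
     (simp_all add: distrib_right gen_def fa_scale_mult(1)[symmetric] monom_append[symmetric] fa_degree0_monom)

lemma fa_degree0_twist: "fa_degree0 (twist q i x) = fa_degree0 x"
  by (induction x rule: free_alg_induct)
     (simp_all add: fa_linear_zero[OF fa_linear_twist] fa_linear_add[OF fa_linear_twist]
         fa_linear_scale[OF fa_linear_twist], simp add: twist_def fa_degree0_monom)

lemma S_form_linear [simp]:
  "S_form q 0 z = 0" "S_form q (x + y) z = S_form q x z + S_form q y z"
  "S_form q (x - y) z = S_form q x z - S_form q y z" "S_form q (fa_scale c x) z = c * S_form q x z"
  "S_form q z 0 = 0" "S_form q z (x + y) = S_form q z x + S_form q z y"
  "S_form q z (x - y) = S_form q z x - S_form q z y" "S_form q z (fa_scale c x) = c * S_form q z x"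
  by (simp_all add: S_form_def J_hom_zero J_hom_add J_hom_scale J_hom_zero_right J_hom_add_right
      J_hom_scale_right fa_linear_diff[OF fa_linear_J_left] fa_linear_diff[OF fa_linear_J_right])

lemma bilinear_form_S_form: "bilinear_form free_algebra (S_form q)"
  by (simp add: bilinear_form_def)

lemma S_form_sum_left: "S_form q (\<Sum>a\<in>A. g a) z = (\<Sum>a\<in>A. S_form q (g a) z)"
  by (induction A rule: infinite_finite_induct) simp_all

lemma S_form_sum_right: "S_form q z (\<Sum>a\<in>A. g a) = (\<Sum>a\<in>A. S_form q z (g a))"
  by (induction A rule: infinite_finite_induct) simp_all

lemma S_form_mult_left: "S_form q (x * y) z = S_form q x (J_hom q y z)"
  by (simp add: S_form_def J_hom_mult)

lemma S_form_one_left: "S_form q 1 x = fa_degree0 x"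
  by (simp add: S_form_def J_hom_one)

text \<open>
  The mirror image of \<open>S(x \<xi>\<^sub>i, z) = S(x, \<partial>\<^sub>i z)\<close>: the two together let \<open>S_form_sym\<close> strip the last letter
  on either side.
\<close>

lemma S_form_mult_gen_right: "S_form q u (x * gen i) = S_form q (partial q i u) x"
  by (simp add: S_form_def J_hom_mult_gen fa_degree0_mult_gen fa_degree0_twist)

lemma J_hom_one_right: "J_hom q x 1 = fa_scale (fa_degree0 x) 1"
proof (induction x rule: free_alg_induct)
  case zero
  then show ?case by (simp add: J_hom_zero)
next
  case (add c w x)
  have "J_hom q (monom w) 1 = fa_scale (fa_degree0 (monom w)) 1"
  proof (induction w)
    case (Cons k w)
    then show ?case
      by (simp add: J_hom_monom partial_scale partial_one fa_degree0_monom)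
  qed (simp add: monom_Nil J_hom_one)
  with add show ?case by (simp add: J_hom_add J_hom_scale fa_scale_add)
qed

lemma S_form_sym: "S_form q x y = S_form q y x"
proof (induction y arbitrary: x rule: free_alg_induct)
  case (add c w y)
  have "S_form q x (monom w) = S_form q (monom w) x"
  proof (induction w arbitrary: x rule: rev_induct)
    case Nil
    then show ?case
      by (simp add: monom_Nil S_form_one_left) (simp add: S_form_def J_hom_one_right)
  next
    case (snoc i w)
    then show ?case
      by (simp add: monom_append S_form_mult_left J_hom_gen S_form_mult_gen_right flip: gen_def)
  qed
  with add show ?case by simp
qed simp

section \<open>The radical\<close>

abbreviation rad :: "('n \<Rightarrow> 'n \<Rightarrow> complex) \<Rightarrow> 'n free_alg set"
  where "rad q \<equiv> radical free_algebra (S_form q)"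

lemma rad_iff: "x \<in> rad q \<longleftrightarrow> (\<forall>y. S_form q x y = 0)"
  by (simp add: radical_def)

text \<open>
  A priori only the degree-0 parts of \<open>J(x) y\<close> vanish. Since \<open>\<partial>\<^sub>i\<close> is adjoint to right multiplication by
  \<open>\<xi>\<^sub>i\<close>, it preserves the radical, so both terms of \<open>J_hom_mult_gen\<close> vanish by induction on \<open>y\<close>.
\<close>

lemma rad_imp_J_hom_zero:
  assumes "x \<in> rad q"
  shows "J_hom q x y = 0"
  using assms
proof (induction y arbitrary: x rule: free_alg_induct)
  case (add c w y)
  have "J_hom q x (monom w) = 0"
    using \<open>x \<in> rad q\<close>
  proof (induction w arbitrary: x rule: rev_induct)
    case Nil
    then have "fa_degree0 x = 0"
      by (metis S_form_one_left S_form_sym rad_iff)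
    then show ?case by (simp add: monom_Nil J_hom_one_right)
  next
    case (snoc i w)
    have "partial q i x \<in> rad q"
      using snoc.prems by (simp add: rad_iff flip: S_form_mult_gen_right)
    then show ?case
      using snoc by (simp add: monom_append J_hom_mult_gen fa_linear_zero[OF fa_linear_twist] flip: gen_def)
  qed
  with add show ?case by (simp add: J_hom_add_right J_hom_scale_right)
qed (simp add: J_hom_zero_right)

lemma rad_iff_J_hom: "x \<in> rad q \<longleftrightarrow> (\<forall>y. J_hom q x y = 0)"
  using rad_imp_J_hom_zero[of x q] by (auto simp: rad_iff S_form_def)

lemma rad_ideal: "ideal (rad q) free_algebra"
proof (rule idealI)
  show "subgroup (rad q) (add_monoid free_algebra)"
  proof (rule group.subgroupI)
    show "Group.group (add_monoid (free_algebra :: (complex, 'a free_alg) module))"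
      by (rule abelian_group.a_group[OF ring.is_abelian_group[OF free_algebra_ring]])
    fix a assume a: "a \<in> rad q"
    have "- a = fa_scale (- 1) a"
      by (rule poly_mapping_eqI) simp
    moreover have "inv\<^bsub>add_monoid free_algebra\<^esub> a = - a"
      by (rule group.inv_equality[OF \<open>Group.group (add_monoid free_algebra)\<close>]) simp_all
    ultimately show "inv\<^bsub>add_monoid free_algebra\<^esub> a \<in> rad q"
      using a by (simp add: rad_iff)
  next
    have "0 \<in> rad q" by (simp add: rad_iff)
    then show "rad q \<noteq> {}" by blast
  qed (simp_all add: rad_iff)
qed (simp_all add: free_algebra_ring rad_iff_J_hom J_hom_mult J_hom_zero_right)

lemma constants_subset_rad: "constants q \<subseteq> rad q"
proof
  fix C assume C: "C \<in> constants q"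
  have "S_form q y C = 0" for y
  proof (induction y rule: free_alg_induct)
    case (add c w x)
    have "S_form q (monom w) C = 0"
    proof (cases w rule: rev_cases)
      case Nil
      then show ?thesis
        using C by (force simp: monom_Nil S_form_one_left fa_degree0_def constants_def fa_positive_def
            in_keys_iff)
    next
      case (snoc v i)
      then show ?thesis
        using C by (simp add: monom_append S_form_mult_left J_hom_gen constants_def flip: gen_def)
    qed
    with add show ?case by simp
  qed simp
  then show "C \<in> rad q" by (simp add: rad_iff S_form_sym)
qed

lemma constants_ideal_subset_rad: "constants_ideal q \<subseteq> rad q"
  unfolding constants_ideal_def
  by (rule ring.genideal_minimal[OF free_algebra_ring rad_ideal constants_subset_rad])

section \<open>Homogeneous elements\<close>

definition homogeneous :: "nat \<Rightarrow> 'n free_alg set"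
  where "homogeneous n = {x. \<forall>w\<in>Poly_Mapping.keys x. length w = n}"

lemma homogeneous_iff: "x \<in> homogeneous n \<longleftrightarrow> (\<forall>w. length w \<noteq> n \<longrightarrow> Poly_Mapping.lookup x w = 0)"
  by (auto simp: homogeneous_def in_keys_iff)

lemma homogeneous_add: "x \<in> homogeneous n \<Longrightarrow> y \<in> homogeneous n \<Longrightarrow> x + y \<in> homogeneous n"
  and homogeneous_diff: "x \<in> homogeneous n \<Longrightarrow> y \<in> homogeneous n \<Longrightarrow> x - y \<in> homogeneous n"
  and homogeneous_scale: "x \<in> homogeneous n \<Longrightarrow> fa_scale c x \<in> homogeneous n"
  and homogeneous_zero: "0 \<in> homogeneous n"
  by (simp_all add: homogeneous_iff lookup_add lookup_minus)

lemma homogeneous_sum: "(\<And>a. a \<in> A \<Longrightarrow> f a \<in> homogeneous n) \<Longrightarrow> sum f A \<in> homogeneous n"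
  by (induction A rule: infinite_finite_induct) (simp_all add: homogeneous_zero homogeneous_add)

lemma homogeneous_monom: "monom w \<in> homogeneous n \<longleftrightarrow> length w = n"
  by (auto simp: homogeneous_def monom_def)

lemma homogeneous_mult:
  "x \<in> homogeneous m \<Longrightarrow> y \<in> homogeneous n \<Longrightarrow> x * y \<in> homogeneous (m + n)"
  using keys_mult[of x y] by (force simp: homogeneous_def plus_list_def)

lemma homogeneous_expand:
  "x = (\<Sum>w\<in>Poly_Mapping.keys x. fa_scale (Poly_Mapping.lookup x w) (monom w))"
proof -
  have "fa_extend monom x = x"
    by (rule fa_linear_eqI[OF fa_linear_extend fa_linear_id]) simp
  then show ?thesis by (simp add: fa_extend_def)
qed

lemma partial_homogeneous:
  assumes "x \<in> homogeneous (Suc n)"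
  shows "partial q i x \<in> homogeneous n"
proof -
  have word: "partial_word q i w \<in> homogeneous (length w - 1)" for w
  proof (induction w)
    case (Cons j w)
    have "gen j * partial_word q i w \<in> homogeneous (length w)"
    proof (cases w)
      case (Cons _ _)
      then show ?thesis
        using Cons.IH homogeneous_mult[of "gen j" 1 "partial_word q i w" "length w - 1"]
        by (simp add: gen_def homogeneous_monom)
    qed (simp add: homogeneous_zero)
    then show ?case
      by (simp add: homogeneous_add homogeneous_scale homogeneous_monom homogeneous_zero)
  qed (simp add: homogeneous_zero)
  have "partial_word q i w \<in> homogeneous n" if "w \<in> Poly_Mapping.keys x" for w
    using assms word[of w] that by (simp add: homogeneous_def)
  then show ?thesis
    unfolding partial_def fa_extend_def by (intro homogeneous_sum homogeneous_scale)
qed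

lemma homogeneous_0: "x \<in> homogeneous 0 \<longleftrightarrow> x = fa_scale (fa_degree0 x) 1"
proof
  assume "x \<in> homogeneous 0"
  then show "x = fa_scale (fa_degree0 x) 1"
    by (intro poly_mapping_eqI)
       (auto simp: homogeneous_iff fa_degree0_def monom_def lookup_single when_def simp flip: monom_Nil)
next
  assume "x = fa_scale (fa_degree0 x) 1"
  then show "x \<in> homogeneous 0"
    by (metis homogeneous_monom homogeneous_scale list.size(3) monom_Nil)
qed

lemma J_word_homogeneous:
  "x \<in> homogeneous (length w + n) \<Longrightarrow> J_word q w x \<in> homogeneous n"
  by (induction w arbitrary: n) (simp_all add: partial_homogeneous)

lemma J_word_homogeneous_eq:
  assumes "x \<in> homogeneous (length w)"
  shows "J_word q w x = fa_scale (S_form q (monom w) x) 1"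
  using J_word_homogeneous[of x w 0 q] assms by (simp add: homogeneous_0 S_form_def J_hom_monom)

text \<open>The last \<open>n\<close> letters of \<open>w\<close> already turn \<open>x\<close> into a scalar, which any further derivation kills.\<close>

lemma J_word_homogeneous_less:
  assumes "x \<in> homogeneous n" "n < length w"
  shows "J_word q w x = 0"
proof -
  define u v where "u = take (length w - n) w" and "v = drop (length w - n) w"
  have w: "w = u @ v" and v: "length v = n" and u: "u \<noteq> []"
    using assms by (auto simp: u_def v_def)
  have "J_word q u 1 = 0"
    using u J_hom_one_right[of q "monom u"] by (simp add: J_hom_monom fa_degree0_monom)
  then show ?thesis
    using J_word_homogeneous_eq[of x v q] assms v by (simp add: w J_word_append J_word_scale)
qed

lemma S_form_monom_length:
  assumes "length u \<noteq> length v"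
  shows "S_form q (monom u) (monom v) = 0"
proof -
  have less: "S_form q (monom u) (monom v) = 0" if "length v < length u" for u v
    using J_word_homogeneous_less[of "monom v" "length v" u q] that
    by (simp add: homogeneous_monom S_form_def J_hom_monom)
  with assms show ?thesis
    by (metis S_form_sym linorder_neqE_nat)
qed

lemma homogeneous_rad_iff:
  assumes "x \<in> homogeneous n"
  shows "x \<in> rad q \<longleftrightarrow> (\<forall>v. length v = n \<longrightarrow> S_form q x (monom v) = 0)"
proof
  assume *: "\<forall>v. length v = n \<longrightarrow> S_form q x (monom v) = 0"
  have "S_form q x (monom v) = 0" for v
  proof (cases "length v = n")
    case False
    have "S_form q x (monom v) =
        (\<Sum>w\<in>Poly_Mapping.keys x. Poly_Mapping.lookup x w * S_form q (monom w) (monom v))"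
      by (subst homogeneous_expand[of x]) (simp add: S_form_sum_left)
    also have "\<dots> = 0"
      using assms False by (intro sum.neutral) (auto simp: homogeneous_def S_form_monom_length)
    finally show ?thesis .
  qed (use * in simp)
  then have "S_form q x y = 0" for y
    by (induction y rule: free_alg_induct) simp_all
  then show "x \<in> rad q" by (simp add: rad_iff)
qed (simp add: rad_iff)

lemma J_word_eventually_zero: "\<exists>m. \<forall>w. m \<le> length w \<longrightarrow> J_word q w x = 0"
proof (induction x rule: free_alg_induct)
  case (add c w x)
  then obtain m where m: "\<forall>v. m \<le> length v \<longrightarrow> J_word q v x = 0" by blast
  have "J_word q v (x + fa_scale c (monom w)) = 0" if "max m (Suc (length w)) \<le> length v" for v
    using m that J_word_homogeneous_less[of "monom w" "length w" v q]
    by (simp add: J_word_add J_word_scale homogeneous_monom)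
  then show ?case by blast
qed (simp add: J_word_zero)

section \<open>Dual systems\<close>

text \<open>
  The canonical element \<open>\<Sum>\<^sub>k b\<^sub>k \<otimes> y\<^sub>k\<close> of a nondegenerate pairing, built by Gaussian elimination over the words in
  \<open>W\<close>. For a new word \<open>u\<close>, the error \<open>r\<close> of the current system at \<open>u\<close> is either in the radical or is added
  as a new \<open>b\<close>, with a partner \<open>z\<close> that pairs to 1 with \<open>u\<close> and to 0 with the earlier words.
\<close>

lemma dual_system:
  assumes "finite W" "\<And>w. w \<in> W \<Longrightarrow> length w = m"
  shows "\<exists>(n::nat) b y. (\<forall>k<n. b k \<in> homogeneous m \<and> y k \<in> homogeneous m) \<and>
    (\<forall>w\<in>W. monom w - (\<Sum>k<n. fa_scale (S_form q (monom w) (y k)) (b k)) \<in> rad q)"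
  using assms
proof (induction W rule: finite_induct)
  case empty
  show ?case by (intro exI[of _ "0 :: nat"]) simp
next
  case (insert u W)
  then obtain n :: nat and b y where hom: "\<And>k. k < n \<Longrightarrow> b k \<in> homogeneous m \<and> y k \<in> homogeneous m"
    and W: "\<And>w. w \<in> W \<Longrightarrow>
      monom w - (\<Sum>k<n. fa_scale (S_form q (monom w) (y k)) (b k)) \<in> rad q"
    using insert.IH[OF insert.prems[OF insertI2]] by blast
  define r where "r = monom u - (\<Sum>k<n. fa_scale (S_form q (monom u) (y k)) (b k))"
  have u: "length u = m" using insert.prems by simp
  have r: "r \<in> homogeneous m"
    unfolding r_def using hom u
    by (auto intro!: homogeneous_diff homogeneous_sum homogeneous_scale simp: homogeneous_monom)
  show ?case
  proof (cases "r \<in> rad q")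
    case True
    with hom W show ?thesis
      by (intro exI[of _ n] exI[of _ b] exI[of _ y]) (auto simp: r_def)
  next
    case False
    then obtain v where v: "length v = m" "S_form q r (monom v) \<noteq> 0"
      using homogeneous_rad_iff[OF r] by blast
    define s where "s = S_form q r (monom v)"
    define z where "z = fa_scale (1 / s) (monom v - (\<Sum>k<n. fa_scale (S_form q (b k) (monom v)) (y k)))"
    have z: "z \<in> homogeneous m"
      unfolding z_def using hom v
      by (auto intro!: homogeneous_diff homogeneous_sum homogeneous_scale simp: homogeneous_monom)
    \<comment> \<open>Pairing with \<open>z\<close> is, up to scale, pairing the current error with \<open>v\<close>; the errors of the words in
        \<open>W\<close> are in the radical, and that of \<open>u\<close> is \<open>r\<close>.\<close>
    have S_z: "S_form q x z =
        (1 / s) * S_form q (x - (\<Sum>k<n. fa_scale (S_form q x (y k)) (b k))) (monom v)" for x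
      by (simp add: z_def S_form_sum_left S_form_sum_right mult.commute)
    have "S_form q (monom u) z = 1"
      using v by (simp add: S_z flip: r_def s_def)
    moreover have "S_form q (monom w) z = 0" if "w \<in> W" for w
      using W[OF that] by (simp only: S_z rad_iff mult_zero_right)
    moreover have "(\<Sum>k<Suc n. fa_scale (S_form q x ((y(n := z)) k)) ((b(n := r)) k)) =
        (\<Sum>k<n. fa_scale (S_form q x (y k)) (b k)) + fa_scale (S_form q x z) r" for x
      by simp
    moreover have "0 \<in> rad q" by (simp add: rad_iff)
    ultimately have "monom w - (\<Sum>k<Suc n. fa_scale (S_form q (monom w) ((y(n := z)) k)) ((b(n := r)) k)) \<in> rad q"
      if "w \<in> insert u W" for w
      using that W[of w] by (cases "w = u") (simp_all add: r_def)
    moreover have "(b(n := r)) k \<in> homogeneous m \<and> (y(n := z)) k \<in> homogeneous m" if "k < Suc n" for k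
      using that hom[of k] r z by (cases "k = n") simp_all
    ultimately show ?thesis by blast
  qed
qed

section \<open>The radical is generated by constants\<close>

lemma J_word_mult_constant:
  assumes "\<And>i. partial q i c = 0"
  shows "J_word q w (y * c) = J_word q w y * c"
  by (induction w) (simp_all add: partial_mult assms)

text \<open>
  Induction on a strict upper bound \<open>m\<close> for the length of the words that do not annihilate \<open>x\<close>. It starts at \<open>m = 0\<close>, where
  the empty word, acting as the identity, shows \<open>x = 0\<close>. Finiteness of the alphabet makes the set of words of
  length \<open>m\<close> finite, as \<open>dual_system\<close> requires.
\<close>

lemma rad_subset_constants_ideal: "rad q \<subseteq> constants_ideal (q :: 'n::finite \<Rightarrow> _)"
proof
  fix x assume "x \<in> rad q"
  interpret I: ideal "constants_ideal q" free_algebra by (rule constants_ideal_ideal)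
  have zero_I: "0 \<in> constants_ideal q"
    using additive_subgroup.zero_closed[OF I.additive_subgroup_axioms] by simp
  have add_I: "a + b \<in> constants_ideal q" if "a \<in> constants_ideal q" "b \<in> constants_ideal q" for a b
    using additive_subgroup.a_closed[OF I.additive_subgroup_axioms that] by simp
  have I_sum: "sum f A \<in> constants_ideal q" if "\<And>k. k \<in> A \<Longrightarrow> f k \<in> constants_ideal q"
    for f :: "nat \<Rightarrow> _" and A
    using that zero_I add_I by (induction A rule: infinite_finite_induct) auto
  obtain m where "\<And>w. m \<le> length w \<Longrightarrow> J_word q w x = 0"
    using J_word_eventually_zero by blast
  with \<open>x \<in> rad q\<close> show "x \<in> constants_ideal q"
  proof (induction m arbitrary: x)
    case 0
    from "0.prems"(2)[of "[]"] have "x = 0" by simp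
    then show ?case using zero_I by simp
  next
    case (Suc m)
    define W :: "'n list set" where "W = {w. length w = m}"
    have "finite W"
      using finite_lists_length_eq[of "UNIV :: 'n set" m] by (simp add: W_def)
    then obtain n :: nat and b y
      where hom: "\<And>k. k < n \<Longrightarrow> b k \<in> homogeneous m \<and> y k \<in> homogeneous m"
        and dual: "\<And>w. length w = m \<Longrightarrow>
          monom w - (\<Sum>k<n. fa_scale (S_form q (monom w) (y k)) (b k)) \<in> rad q"
      using dual_system[of W m q] unfolding W_def by blast
    define c where "c k = J_hom q (b k) x" for k
    have partial_c: "partial q i (c k) = 0" if "k < n" for i k
    proof -
      have *: "partial q i (J_hom q (monom w) x) = 0" if "length w = m" for w
        using Suc.prems(2)[of "i # w"] that by (simp add: J_hom_monom)
      have "partial q i (c k) = (\<Sum>w\<in>Poly_Mapping.keys (b k).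
          fa_scale (Poly_Mapping.lookup (b k) w) (partial q i (J_hom q (monom w) x)))"
        unfolding c_def
        by (subst homogeneous_expand[of "b k"])
           (simp add: fa_linear_sum[OF fa_linear_J_left] fa_linear_sum[OF fa_linear_partial]
             J_hom_scale partial_scale)
      also have "\<dots> = 0"
        using hom[OF that] * by (intro sum.neutral) (auto simp: homogeneous_def)
      finally show ?thesis .
    qed
    have "fa_degree0 (c k) = 0" for k
      using Suc.prems(1) by (metis S_form_def S_form_sym c_def rad_iff)
    then have c_pos: "c k \<in> fa_positive" for k
      by (auto simp: fa_positive_def fa_degree0_def in_keys_iff Suc_le_eq)
    have c_I: "c k \<in> constants_ideal q" if "k < n" for k
    proof (cases "c k = 0")
      case False
      then have "c k \<in> constants q"
        using c_pos partial_c[OF that] by (simp add: constants_def)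
      then show ?thesis
        using ring.genideal_self[OF free_algebra_ring, of "constants q"]
        by (auto simp: constants_ideal_def)
    qed (use zero_I in simp)
    define z where "z = (\<Sum>k<n. y k * c k)"
    have z_I: "z \<in> constants_ideal q"
      unfolding z_def using c_I I.I_l_closed by (intro I_sum) auto
    have J_z: "J_word q w z = (\<Sum>k<n. J_word q w (y k) * c k)" for w
    proof -
      have "J_word q w z = (\<Sum>k<n. J_word q w (y k * c k))"
        by (simp add: z_def fa_linear_sum[OF fa_linear_J_right] flip: J_hom_monom)
      then show ?thesis
        using partial_c by (simp add: J_word_mult_constant)
    qed
    have "J_word q w (x - z) = 0" if w: "m \<le> length w" for w
    proof (cases "length w = m")
      case True
      have "J_word q w z = (\<Sum>k<n. fa_scale (S_form q (monom w) (y k)) (c k))"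
        unfolding J_z using hom True
        by (intro sum.cong) (auto simp: J_word_homogeneous_eq fa_scale_mult(1)[symmetric])
      then have "J_word q w (x - z) =
          J_hom q (monom w - (\<Sum>k<n. fa_scale (S_form q (monom w) (y k)) (b k))) x"
        by (simp add: c_def fa_linear_diff[OF fa_linear_J_left] fa_linear_sum[OF fa_linear_J_left]
            J_hom_scale fa_linear_diff[OF fa_linear_J_right] flip: J_hom_monom)
      also have "\<dots> = 0" by (rule rad_imp_J_hom_zero[OF dual[OF True]])
      finally show ?thesis .
    next
      case False
      then have "J_word q w z = 0"
        unfolding J_z using hom w J_word_homogeneous_less[of _ m w q]
        by (intro sum.neutral) auto
      then show ?thesis
        using False w Suc.prems(2)[of w]
        by (simp add: fa_linear_diff[OF fa_linear_J_right] flip: J_hom_monom)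
    qed
    moreover have "x - z \<in> rad q"
      using Suc.prems(1) z_I constants_ideal_subset_rad[of q] by (auto simp: rad_iff)
    ultimately have "x - z \<in> constants_ideal q" by (intro Suc.IH)
    from add_I[OF this z_I] show ?case by simp
  qed
qed

lemma rad_eq_constants_ideal: "rad q = constants_ideal (q :: 'n::finite \<Rightarrow> _)"
  by (intro antisym rad_subset_constants_ideal constants_ideal_subset_rad)

section \<open>The form on the quotient\<close>

theorem corollary1p6p4:
  fixes q :: "'n::finite \<Rightarrow> 'n \<Rightarrow> complex"
  shows "bilinear_form free_algebra (S_form q) \<and>
    symmetric_form free_algebra (S_form q) \<and>
    radical free_algebra (S_form q) = constants_ideal q \<and>
    (\<exists>S'. (\<forall>x y. S' (constants_ideal q +>\<^bsub>free_algebra\<^esub> x) (constants_ideal q +>\<^bsub>free_algebra\<^esub> y)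
                = S_form q x y) \<and>
      bilinear_form (quotient_algebra free_algebra (constants_ideal q)) S' \<and>
      nondegenerate_form (quotient_algebra free_algebra (constants_ideal q)) S')"
proof -
  interpret I: ideal "constants_ideal q" free_algebra by (rule constants_ideal_ideal)
  have zero_I: "0 \<in> constants_ideal q"
    by (simp add: rad_iff flip: rad_eq_constants_ideal)
  let ?coset = "\<lambda>x. constants_ideal q +>\<^bsub>free_algebra\<^esub> x"
  have coset_iff: "z \<in> ?coset x \<longleftrightarrow> z - x \<in> constants_ideal q" for x z
    by (auto simp: a_r_coset_def r_coset_def intro: bexI[of _ "z - x"])
  define S' where "S' X Y = S_form q (SOME x. x \<in> X) (SOME y. y \<in> Y)" for X Y
  have rep: "(SOME z. z \<in> ?coset x) - x \<in> rad q" for x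
    unfolding rad_eq_constants_ideal coset_iff[symmetric]
    by (rule someI[of _ x]) (simp add: coset_iff zero_I)
  have S': "S' (?coset x) (?coset y) = S_form q x y" for x y
  proof -
    let ?x = "SOME z. z \<in> ?coset x" and ?y = "SOME z. z \<in> ?coset y"
    have "S_form q (?x - x) ?y = 0" "S_form q (?y - y) x = 0"
      using rep rad_iff by blast+
    then show ?thesis
      by (simp add: S'_def S_form_sym[of q _ x])
  qed
  have carrier: "a_rcosets\<^bsub>free_algebra\<^esub> constants_ideal q = range ?coset"
    by (auto simp: A_RCOSETS_def' a_r_coset_def)
  have add: "set_add free_algebra (?coset x) (?coset y) = ?coset (x + y)" for x y
    using I.a_rcos_sum[of x y] by simp
  have smult: "(\<Union>z\<in>?coset x. ?coset (c \<odot>\<^bsub>free_algebra\<^esub> z)) =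
      ?coset (c \<odot>\<^bsub>free_algebra\<^esub> x)" for c x
    using quotient_algebra_smult[OF I.ideal_axioms, of c x] by simp
  have zero: "?coset x = constants_ideal q" if "\<And>y. S_form q x y = 0" for x
  proof -
    have "x \<in> constants_ideal q"
      using that by (simp add: rad_iff flip: rad_eq_constants_ideal)
    then show ?thesis by (rule I.a_rcos_const)
  qed
  have "bilinear_form (quotient_algebra free_algebra (constants_ideal q)) S'"
    unfolding bilinear_form_def quotient_algebra_simps carrier
    by (simp add: add smult S' del: free_algebra_simps(6)) simp
  moreover have "nondegenerate_form (quotient_algebra free_algebra (constants_ideal q)) S'"
    unfolding nondegenerate_form_def quotient_algebra_simps carrier
  proof (intro conjI ballI impI; elim imageE)
    fix X x assume *: "\<forall>Y\<in>range ?coset. S' X Y = 0" "X = ?coset x"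
    show "X = constants_ideal q"
      unfolding *(2) by (rule zero) (use * S' in auto)
  next
    fix Y y assume *: "\<forall>X\<in>range ?coset. S' X Y = 0" "Y = ?coset y"
    show "Y = constants_ideal q"
      unfolding *(2) by (rule zero, subst S_form_sym) (use * S' in auto)
  qed
  moreover have "symmetric_form free_algebra (S_form q)"
    by (simp add: symmetric_form_def S_form_sym)
  ultimately show ?thesis
    using S' by (intro conjI exI[of _ S'] bilinear_form_S_form rad_eq_constants_ideal) simp_all
qed

end
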